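(* Let $\varepsilon>0$ be a constant, let $p=p(n)\le(1-\varepsilon)\log(n)/n$, and let $G$ be an Erdős–Rényi random graph $\mathcal G(n,p)$ with adjacency matrix $A$ and Laplacian matrix $L$. Then, almost surely, both for the (rescaled) adjacency matrix $M_G=\gamma A$ and for the (rescaled) Laplacian matrix $M_G=\gamma L$, $\gamma\in\mathbb R$, there exist vertices $w\in V$ which cannot be found by quantum spatial search in $o(n)$ time.
   Context: $\mathcal G(n,p)$ is the random simple undirected graph on $V=\{1,\dots,n\}$ in which each possible edge is present independently with probability $p$. The Laplacian is $L=D-A$ with $D$ the diagonal degree matrix. $\{|v\rangle:v\in V\}$ is the standard orthonormal basis of $\mathbb C^n$ and $|s\rangle=\frac1{\sqrt n}\sum_{v\in V}|v\rangle$. Quantum spatial search for a marked vertex $w$ with a Hermitian matrix $M_G$ starts in $|s\rangle$ and evolves by $|\dot\psi_t\rangle=-\mathrm iH|\psi_t\rangle$ with $H=-M_G-|w\rangle\langle w|$. Measuring at time $t\ge 0$ finds $w$ with probability $P_w(t)=|\langle w|\exp(-\mathrm iHt)|s\rangle|^2$. The procedure (prepare $|s\rangle$, evolve for time $t$, measure) is repeated until $w$ is found; each round costs the evolution time $t$ plus unit cost for preparation and measurement, so the expected time to find $w$ using measurement time $t$ is $(1+t)/P_w(t)$. "Cannot be found in $o(n)$ time" means that $\inf_{t\ge0}(1+t)/P_w(t)=\Omega(n)$, i.e. it is at least $Cn$ for an absolute constant $C>0$. "Almost surely" means with probability $1-o(1)$ over the choice of $G$ as $n\to\infty$. *)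

theory Defs
  imports "HOL-Probability.Probability" "Jordan_Normal_Form.Matrix"
begin

hide_const (open) Finite_Cartesian_Product.vec Finite_Cartesian_Product.mat
  Finite_Cartesian_Product.row Finite_Cartesian_Product.column

text \<open>
  A simple graph on \<open>n\<close> vertices is represented by its edge set, a set of two-element
  subsets of \<open>{..<n}\<close>.  The vertices are numbered from \<open>0\<close> to match the matrix indices.
\<close>

definition potential_edges :: "nat \<Rightarrow> nat set set" where
  "potential_edges n = {e. e \<subseteq> {..<n} \<and> card e = 2}"

definition gnp :: "nat \<Rightarrow> real \<Rightarrow> nat set set pmf" where
  "gnp n p = map_pmf (\<lambda>b. {e \<in> potential_edges n. b e})
     (Pi_pmf (potential_edges n) False (\<lambda>_. bernoulli_pmf p))"

definition degree :: "nat set set \<Rightarrow> nat \<Rightarrow> nat" where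
  "degree E v = card {u. {v, u} \<in> E}"

definition adjacency_mat :: "nat \<Rightarrow> nat set set \<Rightarrow> complex mat" where
  "adjacency_mat n E = mat n n (\<lambda>(u, v). if {u, v} \<in> E then 1 else 0)"

definition degree_mat :: "nat \<Rightarrow> nat set set \<Rightarrow> complex mat" where
  "degree_mat n E = mat n n (\<lambda>(u, v). if u = v then of_nat (degree E v) else 0)"

definition laplacian_mat :: "nat \<Rightarrow> nat set set \<Rightarrow> complex mat" where
  "laplacian_mat n E = degree_mat n E - adjacency_mat n E"

text \<open>
  Matrices of varying dimension do not form a Banach algebra type, so the exponential
  series is summed entrywise; it converges by \<open>mat_exp_summable\<close> below.
\<close>

definition mat_exp :: "complex mat \<Rightarrow> complex mat" where
  "mat_exp A = mat (dim_row A) (dim_row A) (\<lambda>(i, j). \<Sum>k. (A ^\<^sub>m k) $$ (i, j) / fact k)"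

lemma pow_mat_entry_bound:
  fixes A :: "complex mat"
  assumes A: "A \<in> carrier_mat n n" and i: "i < n" and j: "j < n"
    and B: "\<And>i j. i < n \<Longrightarrow> j < n \<Longrightarrow> norm (A $$ (i, j)) \<le> B"
  shows "norm ((A ^\<^sub>m k) $$ (i, j)) \<le> (real n * B) ^ k"
  using j
proof (induction k arbitrary: j)
  case 0
  then show ?case using A i by auto
next
  case (Suc k)
  have Ak: "A ^\<^sub>m k \<in> carrier_mat n n" using A by simp
  have "(A ^\<^sub>m Suc k) $$ (i, j) = (\<Sum>l = 0..<n. (A ^\<^sub>m k) $$ (i, l) * A $$ (l, j))"
    using A Ak i Suc.prems by (simp add: scalar_prod_def)
  also have "norm \<dots> \<le> (\<Sum>l = 0..<n. (real n * B) ^ k * B)"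
  proof (rule sum_norm_le)
    fix l assume "l \<in> {0..<n}"
    then have l: "l < n" by simp
    have "norm ((A ^\<^sub>m k) $$ (i, l) * A $$ (l, j))
        = norm ((A ^\<^sub>m k) $$ (i, l)) * norm (A $$ (l, j))" by (rule norm_mult)
    also have "\<dots> \<le> (real n * B) ^ k * B"
      using Suc.IH[OF l] B[OF l Suc.prems]
      by (meson mult_mono norm_ge_zero order_trans)
    finally show "norm ((A ^\<^sub>m k) $$ (i, l) * A $$ (l, j)) \<le> (real n * B) ^ k * B" .
  qed
  also have "\<dots> = (real n * B) ^ Suc k" by simp
  finally show ?case .
qed

lemma mat_exp_summable:
  fixes A :: "complex mat"
  assumes A: "A \<in> carrier_mat n n" and i: "i < n" and j: "j < n"
  shows "summable (\<lambda>k. (A ^\<^sub>m k) $$ (i, j) / fact k)"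
proof -
  define B where "B = Max ((\<lambda>(i, j). norm (A $$ (i, j))) ` ({..<n} \<times> {..<n}))"
  have B: "norm (A $$ (i, j)) \<le> B" if "i < n" "j < n" for i j
    unfolding B_def by (rule Max_ge) (use that in auto)
  show ?thesis
  proof (rule summable_comparison_test')
    show "summable (\<lambda>k. inverse (fact k) * (real n * B) ^ k)" by (rule summable_exp)
    show "norm ((A ^\<^sub>m k) $$ (i, j) / fact k) \<le> inverse (fact k) * (real n * B) ^ k" for k
      using pow_mat_entry_bound[OF A i j B, of k]
      by (simp add: norm_divide divide_simps)
  qed
qed

text \<open>The uniform superposition \<open>|s\<rangle>\<close> and the projector \<open>|w\<rangle>\<langle>w|\<close>.\<close>

definition uniform_state :: "nat \<Rightarrow> complex vec" where
  "uniform_state n = vec n (\<lambda>_. 1 / of_real (sqrt (real n)))"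

definition marked_proj :: "nat \<Rightarrow> nat \<Rightarrow> complex mat" where
  "marked_proj n w = mat n n (\<lambda>(i, j). if i = w \<and> j = w then 1 else 0)"

definition search_hamiltonian :: "nat \<Rightarrow> complex mat \<Rightarrow> nat \<Rightarrow> complex mat" where
  "search_hamiltonian n M w = - M - marked_proj n w"

definition success_prob :: "nat \<Rightarrow> complex mat \<Rightarrow> nat \<Rightarrow> real \<Rightarrow> real" where
  "success_prob n M w t =
     (cmod ((mat_exp ((- \<i> * of_real t) \<cdot>\<^sub>m search_hamiltonian n M w) *\<^sub>v uniform_state n)
            \<bullet>c unit_vec n w))\<^sup>2"

text \<open>
  The quotient is taken in \<^typ>\<open>ennreal\<close>, so that a measurement time with success
  probability \<open>0\<close> has infinite (rather than zero) expected cost.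
\<close>

definition search_time :: "nat \<Rightarrow> complex mat \<Rightarrow> nat \<Rightarrow> ennreal" where
  "search_time n M w = (INF t\<in>{0..}. ennreal (1 + t) / ennreal (success_prob n M w t))"

end

theory Submission
  imports Defs "HOL-Real_Asymp.Real_Asymp"
begin

text \<open>
  If \<open>w\<close> is isolated, row \<open>w\<close> of \<open>\<gamma>A\<close> and of \<open>\<gamma>L\<close> vanishes, so \<open>\<langle>w|\<close> is a left eigenvector of
  the Hamiltonian with eigenvalue \<open>-1\<close>.  The amplitude at \<open>w\<close> therefore only changes by a phase,
  the success probability stays \<open>1/n\<close> at all times, and the search costs at least \<open>n\<close>.
  Isolated vertices exist almost surely by the second moment method: their expected number
  \<open>\<mu> = n(1-p)\<^sup>n\<^sup>-\<^sup>1\<close> is at least \<open>n\<^sup>\<epsilon>\<close> up to a constant factor, and by Chebyshev's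
  inequality there is none with probability at most \<open>1/\<mu> + 1/(1-p) - 1\<close>.
\<close>

section \<open>Time evolution at an isolated vertex\<close>

definition isolated :: "nat set set \<Rightarrow> nat \<Rightarrow> bool" where
  "isolated E w \<longleftrightarrow> (\<forall>u. {w, u} \<notin> E)"

text \<open>By \<open>row\<close>, the unit row vector at \<open>w\<close> is a left eigenvector of
  \<open>A\<close>. Each further power multiplies on the right, so it only rescales that vector by
  \<open>c\<close>.\<close>

lemma pow_mat_eigenrow:
  fixes A :: "complex mat"
  assumes A: "A \<in> carrier_mat n n" and w: "w < n"
    and row: "\<And>j. j < n \<Longrightarrow> A $$ (w, j) = (if j = w then c else 0)"
    and j: "j < n"
  shows "(A ^\<^sub>m k) $$ (w, j) = (if j = w then c ^ k else 0)"
  using j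
proof (induction k arbitrary: j)
  case 0
  then show ?case using A w by auto
next
  case (Suc k)
  have Ak: "A ^\<^sub>m k \<in> carrier_mat n n" using A by simp
  have "(A ^\<^sub>m Suc k) $$ (w, j) = (\<Sum>l = 0..<n. (A ^\<^sub>m k) $$ (w, l) * A $$ (l, j))"
    using A Ak w Suc.prems by (simp add: scalar_prod_def)
  also have "\<dots> = (\<Sum>l = 0..<n. if l = w then c ^ k * A $$ (w, j) else 0)"
    by (rule sum.cong) (auto simp: Suc.IH)
  also have "\<dots> = c ^ k * A $$ (w, j)"
    using w by simp
  finally show ?case
    using row[OF Suc.prems] by simp
qed

lemma mat_exp_eigenrow:
  fixes A :: "complex mat"
  assumes A: "A \<in> carrier_mat n n" and w: "w < n"
    and row: "\<And>j. j < n \<Longrightarrow> A $$ (w, j) = (if j = w then c else 0)"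
    and j: "j < n"
  shows "mat_exp A $$ (w, j) = (if j = w then exp c else 0)"
proof -
  have "mat_exp A $$ (w, j) = (\<Sum>k. (if j = w then c ^ k else 0) / fact k)"
    using A w j pow_mat_eigenrow[OF assms] by (simp add: mat_exp_def)
  also have "\<dots> = (if j = w then exp c else 0)"
    by (simp add: exp_def scaleR_conv_of_real divide_inverse mult.commute)
  finally show ?thesis .
qed

lemma success_prob_zero_row:
  assumes M: "M \<in> carrier_mat n n" and w: "w < n"
    and row: "\<And>j. j < n \<Longrightarrow> M $$ (w, j) = 0"
  shows "success_prob n M w t = 1 / real n"
proof -
  define A where "A = (- \<i> * of_real t) \<cdot>\<^sub>m search_hamiltonian n M w"
  have A: "A \<in> carrier_mat n n"
    unfolding A_def search_hamiltonian_def marked_proj_def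
    by (intro smult_carrier_mat minus_carrier_mat mat_carrier)
  \<comment> \<open>The minus signs of \<open>- \<i> * of_real t\<close> and of the projector
    cancel. The eigenvalue is purely imaginary, so its exponential is the phase
    \<open>cis t\<close>.\<close>
  have "A $$ (w, j) = (if j = w then \<i> * of_real t else 0)" if "j < n" for j
    using M w that row[OF that] by (simp add: A_def search_hamiltonian_def marked_proj_def)
  then have E: "mat_exp A $$ (w, j) = (if j = w then cis t else 0)" if "j < n" for j
    using mat_exp_eigenrow[OF A w _ that, of "\<i> * of_real t"] by (simp add: cis_conv_exp)
  have dim: "dim_row (mat_exp A) = n" "dim_col (mat_exp A) = n"
    using A by (simp_all add: mat_exp_def)
  define x where "x = mat_exp A *\<^sub>v uniform_state n"
  have "x \<bullet>c unit_vec n w = (\<Sum>i = 0..<n. if i = w then x $ w else 0)"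
    unfolding scalar_prod_def by (rule sum.cong) (use w in auto)
  also have "\<dots> = (\<Sum>j = 0..<n. mat_exp A $$ (w, j) / of_real (sqrt (real n)))"
    using w dim by (simp add: x_def scalar_prod_def uniform_state_def)
  also have "\<dots> = (\<Sum>j = 0..<n. if j = w then cis t / of_real (sqrt (real n)) else 0)"
    by (rule sum.cong) (auto simp: E)
  also have "\<dots> = cis t / of_real (sqrt (real n))"
    using w by simp
  finally show ?thesis
    by (simp add: success_prob_def A_def x_def norm_divide power_divide)
qed

lemma search_time_zero_row:
  assumes M: "M \<in> carrier_mat n n" and w: "w < n"
    and row: "\<And>j. j < n \<Longrightarrow> M $$ (w, j) = 0"
  shows "ennreal (real n) \<le> search_time n M w"
  unfolding search_time_def
proof (rule INF_greatest)
  fix t :: real assume "t \<in> {0..}"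
  then have t: "0 \<le> t" by simp
  \<comment> \<open>The success probability \<open>1 / real n\<close> is positive because
    \<open>w < n\<close>, so the quotient in \<open>ennreal\<close> is the ordinary real
    one.\<close>
  have "ennreal (1 + t) / ennreal (success_prob n M w t) = ennreal ((1 + t) * real n)"
    using t w by (subst success_prob_zero_row[OF assms])
      (simp_all add: divide_ennreal del: ennreal_plus)
  moreover have "real n \<le> (1 + t) * real n"
    using t by (simp add: algebra_simps)
  ultimately show "ennreal (real n) \<le> ennreal (1 + t) / ennreal (success_prob n M w t)"
    by (simp add: ennreal_leI)
qed

text \<open>The diagonal entry of the Laplacian vanishes because \<open>w\<close> has degree 0. The
  same \<open>w\<close> serves every \<gamma> and both matrices, so it suffices to control one event
  that does not mention \<gamma>.\<close>

lemma isolated_not_found: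
  assumes "isolated E w" "w < n"
  shows "ennreal (real n) \<le> search_time n (of_real \<gamma> \<cdot>\<^sub>m adjacency_mat n E) w"
    and "ennreal (real n) \<le> search_time n (of_real \<gamma> \<cdot>\<^sub>m laplacian_mat n E) w"
  using assms
  by (auto intro!: search_time_zero_row
      simp: isolated_def adjacency_mat_def laplacian_mat_def degree_mat_def degree_def)

section \<open>Second moment method\<close>

text \<open>Chebyshev for the number \<open>X\<close> of events that occur: \<open>X = 0\<close> is
  a deviation of \<mu> from the mean. The double sum is the second moment of \<open>X\<close>, with
  the diagonal \<open>v = w\<close> included; subtracting \<mu>^2 for the variance gives the final
  \<open>- 1\<close>.\<close>

lemma prob_no_event_le:
  fixes M :: "'a pmf"
  assumes mu: "\<mu> = (\<Sum>w\<in>W. measure_pmf.prob M {x. P w x})" "\<mu> > 0"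
  shows "measure_pmf.prob M {x. \<forall>w\<in>W. \<not> P w x}
    \<le> (\<Sum>v\<in>W. \<Sum>w\<in>W. measure_pmf.prob M {x. P v x \<and> P w x}) / \<mu>\<^sup>2 - 1"
proof -
  define X where "X = (\<lambda>x. \<Sum>w\<in>W. indicator {x. P w x} x :: real)"
  have int: "integrable (measure_pmf M) (\<lambda>x. indicator S x :: real)" for S
    by (rule measure_pmf.integrable_const_bound[where B = 1]) auto
  have X2: "(X x)\<^sup>2 = (\<Sum>v\<in>W. \<Sum>w\<in>W. indicator {x. P v x \<and> P w x} x)" for x
    unfolding X_def power2_eq_square sum_product
    by (intro sum.cong refl) (auto simp: indicator_def)
  have EX: "measure_pmf.expectation M X = \<mu>"
    unfolding X_def mu by (simp add: int)
  have iX: "integrable (measure_pmf M) X"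
    unfolding X_def by (simp add: int)
  have iX2: "integrable (measure_pmf M) (\<lambda>x. (X x)\<^sup>2)"
    unfolding X2 by (simp add: int)
  have EX2: "measure_pmf.expectation M (\<lambda>x. (X x)\<^sup>2)
      = (\<Sum>v\<in>W. \<Sum>w\<in>W. measure_pmf.prob M {x. P v x \<and> P w x})"
    unfolding X2 by (simp add: int)
  have "{x. \<forall>w\<in>W. \<not> P w x} \<subseteq> {x \<in> space (measure_pmf M). \<mu> \<le> \<bar>X x - measure_pmf.expectation M X\<bar>}"
    using mu(2) by (auto simp: EX) (auto simp: X_def indicator_def intro!: sum.neutral)
  then have "measure_pmf.prob M {x. \<forall>w\<in>W. \<not> P w x}
      \<le> measure_pmf.prob M {x \<in> space (measure_pmf M). \<mu> \<le> \<bar>X x - measure_pmf.expectation M X\<bar>}"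
    by (intro measure_pmf.finite_measure_mono) auto
  also have "\<dots> \<le> measure_pmf.variance M X / \<mu>\<^sup>2"
    by (intro measure_pmf.Chebyshev_inequality iX2 mu(2)) auto
  also have "measure_pmf.variance M X = measure_pmf.expectation M (\<lambda>x. (X x)\<^sup>2) - \<mu>\<^sup>2"
    by (subst measure_pmf.variance_eq[OF iX iX2]) (simp add: EX)
  finally show ?thesis
    using mu(2) by (simp add: EX2 diff_divide_distrib)
qed

section \<open>Isolation probabilities in the random graph\<close>

lemma finite_potential_edges: "finite (potential_edges n)"
  by (rule finite_subset[of _ "Pow {..<n}"]) (auto simp: potential_edges_def)

text \<open>Avoiding \<open>S\<close> is a product event for the independent edge coins: each coin
  in \<open>S\<close> must be \<open>False\<close>, with factor \<open>1 - p\<close>, and the others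
  are free.\<close>

lemma prob_gnp_avoids:
  assumes p: "0 \<le> p" "p \<le> 1" and S: "S \<subseteq> potential_edges n"
  shows "measure_pmf.prob (gnp n p) {E. E \<inter> S = {}} = (1 - p) ^ card S"
proof -
  let ?P = "potential_edges n"
  define B where "B = (\<lambda>e. if e \<in> S then {False} else UNIV)"
  let ?M = "Pi_pmf ?P False (\<lambda>_. bernoulli_pmf p)"
  have "measure_pmf.prob (gnp n p) {E. E \<inter> S = {}}
      = measure_pmf.prob ?M {b. {e \<in> ?P. b e} \<inter> S = {}}"
    by (simp add: gnp_def vimage_def)
  also have "{b. {e \<in> ?P. b e} \<inter> S = {}} = Pi ?P B"
    using S by (auto simp: B_def Pi_def)
  also have "measure_pmf.prob ?M (Pi ?P B) = (\<Prod>e\<in>?P. measure_pmf.prob (bernoulli_pmf p) (B e))"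
    by (rule measure_Pi_pmf_Pi) (rule finite_potential_edges)
  also have "\<dots> = (\<Prod>e\<in>?P. if e \<in> S then 1 - p else 1)"
    by (intro prod.cong refl) (use p in \<open>auto simp: B_def measure_pmf_single\<close>)
  also have "\<dots> = (\<Prod>e\<in>S. 1 - p)"
    using S by (subst prod.inter_restrict[symmetric, OF finite_potential_edges])
      (simp add: Int_absorb1)
  finally show ?thesis by simp
qed

definition star_edges :: "nat \<Rightarrow> nat \<Rightarrow> nat set set" where
  "star_edges n w = (\<lambda>u. {w, u}) ` ({..<n} - {w})"

lemma star_edges_subset: "w < n \<Longrightarrow> star_edges n w \<subseteq> potential_edges n"
  by (auto simp: star_edges_def potential_edges_def)

lemma card_star_edges: "w < n \<Longrightarrow> card (star_edges n w) = n - 1"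
  unfolding star_edges_def
  by (subst card_image) (auto simp: inj_on_def doubleton_eq_iff)

lemma star_edges_Int:
  assumes "v < n" "w < n" "v \<noteq> w"
  shows "star_edges n v \<inter> star_edges n w = {{v, w}}"
  using assms by (fastforce simp: star_edges_def doubleton_eq_iff)

text \<open>The two stars share exactly the edge \<open>{v, w}\<close>. This one edge causes the
  whole correlation between two isolation events. The \<open>Suc\<close> avoids truncated
  subtraction.\<close>

lemma card_star_edges_Un:
  assumes "v < n" "w < n" "v \<noteq> w"
  shows "Suc (card (star_edges n v \<union> star_edges n w)) = 2 * (n - 1)"
proof -
  have "finite (star_edges n u)" for u
    by (simp add: star_edges_def)
  then show ?thesis
    using card_Un_Int[of "star_edges n v" "star_edges n w"] star_edges_Int[OF assms] assms
    by (simp add: card_star_edges)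
qed

text \<open>Turns isolation into avoidance of a finite edge set, as \<open>prob_gnp_avoids\<close>
  requires. The assumption excludes the loop \<open>{w}\<close> and neighbours outside
  \<open>{..<n}\<close>.\<close>

lemma isolated_iff_star_edges:
  assumes "E \<subseteq> potential_edges n"
  shows "isolated E w \<longleftrightarrow> E \<inter> star_edges n w = {}"
proof -
  have "u \<in> {..<n} - {w}" if "{w, u} \<in> E" for u
    using assms that by (cases "u = w") (auto simp: potential_edges_def)
  then show ?thesis
    by (auto simp: isolated_def star_edges_def)
qed

lemma AE_gnp_subset: "AE E in measure_pmf (gnp n p). E \<subseteq> potential_edges n"
  by (auto simp: AE_measure_pmf_iff gnp_def)

text \<open>With \<open>q = 1 - p\<close>, two distinct vertices are both isolated with probability
  \<open>q ^ (2 * (n - 1))\<close> divided by \<open>q\<close>. Distinct pairs thus add at most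
  \<mu>^2 / q to the second moment, and the diagonal adds \<mu>.\<close>

lemma prob_no_isolated_le:
  assumes p: "0 \<le> p" "p < 1" and n: "2 \<le> n"
  shows "measure_pmf.prob (gnp n p) {E. \<forall>w<n. \<not> isolated E w}
    \<le> 1 / (real n * (1 - p) ^ (n - 1)) + 1 / (1 - p) - 1"
proof -
  define q where "q = 1 - p"
  have q: "0 < q" using p by (simp add: q_def)
  let ?P = "\<lambda>w E. E \<inter> star_edges n w = {}"
  have one: "measure_pmf.prob (gnp n p) {E. ?P w E} = q ^ (n - 1)" if "w < n" for w
    using prob_gnp_avoids[of p "star_edges n w" n] p that
    by (simp add: star_edges_subset card_star_edges q_def)
  have two: "measure_pmf.prob (gnp n p) {E. ?P v E \<and> ?P w E}
      = (if v = w then q ^ (n - 1) else q ^ (2 * (n - 1) - 1))" if "v < n" "w < n" for v w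
  proof (cases "v = w")
    case True
    then show ?thesis using one[OF that(1)] by simp
  next
    case False
    have "{E. ?P v E \<and> ?P w E} = {E. E \<inter> (star_edges n v \<union> star_edges n w) = {}}"
      by blast
    moreover have "card (star_edges n v \<union> star_edges n w) = 2 * (n - 1) - 1"
      using card_star_edges_Un[OF that False] by simp
    ultimately show ?thesis
      using prob_gnp_avoids[of p "star_edges n v \<union> star_edges n w" n] p that False
      by (simp add: star_edges_subset q_def)
  qed
  define \<mu> where "\<mu> = real n * q ^ (n - 1)"
  have \<mu>: "0 < \<mu>" using q n by (simp add: \<mu>_def)
  have \<mu>_sum: "\<mu> = (\<Sum>w<n. measure_pmf.prob (gnp n p) {E. ?P w E})"
    by (simp add: one \<mu>_def)
  have "measure_pmf.prob (gnp n p) {E. \<forall>w<n. \<not> isolated E w}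
      = measure_pmf.prob (gnp n p) {E. \<forall>w\<in>{..<n}. \<not> ?P w E}"
    \<comment> \<open>The two events are identified only on sets of potential edges, which carry all
      the mass.\<close>
    using AE_gnp_subset[of n p]
    by (intro measure_pmf.finite_measure_eq_AE) (auto simp: isolated_iff_star_edges)
  also have "\<dots> \<le> (\<Sum>v<n. \<Sum>w<n. measure_pmf.prob (gnp n p) {E. ?P v E \<and> ?P w E}) / \<mu>\<^sup>2 - 1"
    using \<mu> by (intro prob_no_event_le \<mu>_sum) auto
  also have "(\<Sum>v<n. \<Sum>w<n. measure_pmf.prob (gnp n p) {E. ?P v E \<and> ?P w E})
      = (\<Sum>v<n. \<Sum>w<n. if v = w then q ^ (n - 1) else q ^ (2 * (n - 1) - 1))"
    by (intro sum.cong refl two) auto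
  also have "\<dots> = (\<Sum>v<n. q ^ (n - 1) + real (n - 1) * q ^ (2 * (n - 1) - 1))"
  proof (intro sum.cong refl)
    fix v assume "v \<in> {..<n}"
    then show "(\<Sum>w<n. if v = w then q ^ (n - 1) else q ^ (2 * (n - 1) - 1))
        = q ^ (n - 1) + real (n - 1) * q ^ (2 * (n - 1) - 1)"
      by (simp add: sum.remove[of "{..<n}" v])
  qed
  also have "\<dots> = \<mu> + real n * real (n - 1) * q ^ (2 * (n - 1) - 1)"
    using n by (simp add: \<mu>_def distrib_left mult.assoc of_nat_diff)
  also have "\<dots> \<le> \<mu> + \<mu>\<^sup>2 / q"
  proof -
    \<comment> \<open>Since \<open>2 \<le> n\<close>, the exponent is positive and one factor
      \<open>q\<close> can be split off.\<close>
    have "q ^ (2 * (n - 1)) = q ^ (2 * (n - 1) - 1) * q"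
      using n by (subst power_Suc2[symmetric]) (simp add: Suc_diff_Suc)
    moreover have "\<mu>\<^sup>2 = real n * real n * q ^ (2 * (n - 1))"
      by (simp add: \<mu>_def power2_eq_square mult_2 power_add)
    ultimately have "\<mu>\<^sup>2 / q = real n * real n * q ^ (2 * (n - 1) - 1)"
      using q by simp
    moreover have "real n * real (n - 1) * q ^ (2 * (n - 1) - 1) \<le> real n * real n * q ^ (2 * (n - 1) - 1)"
      using q by (intro mult_mono) auto
    ultimately show ?thesis by simp
  qed
  finally have "measure_pmf.prob (gnp n p) {E. \<forall>w<n. \<not> isolated E w} \<le> 1 / \<mu> + 1 / q - 1"
    using \<mu> by (simp add: divide_right_mono add_divide_distrib power2_eq_square)
  then show ?thesis
    by (simp add: \<mu>_def q_def)
qed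

section \<open>Asymptotics below the connectivity threshold\<close>

text \<open>Replacing \<open>p n\<close> by its upper bound \<open>q n\<close> only increases the
  bound. As \<open>n * q n\<close> is (1 - \<epsilon>) ln n, the estimate ln(1 - x) >= -x - 2x^2
  leaves \<epsilon> ln n in the exponent, up to a vanishing error.\<close>

lemma prob_no_isolated_tendsto_0:
  fixes p :: "nat \<Rightarrow> real"
  assumes \<epsilon>: "0 < \<epsilon>"
    and p: "\<And>n. 1 \<le> n \<Longrightarrow> 0 \<le> p n \<and> p n \<le> (1 - \<epsilon>) * ln (real n) / real n"
  shows "(\<lambda>n. measure_pmf.prob (gnp n (p n)) {E. \<forall>w<n. \<not> isolated E w}) \<longlonglongrightarrow> 0"
proof -
  define q where "q n = (1 - \<epsilon>) * ln (real n) / real n" for n :: nat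
  \<comment> \<open>Chosen so that the quadratic error \<open>n * 2 * (q n)^2\<close> equals c (ln
    n)^2 / n.\<close>
  define c where "c = 2 * (1 - \<epsilon>)\<^sup>2"
  let ?b = "\<lambda>n. exp (c * ((ln (real n))\<^sup>2 / real n)) * exp (- (\<epsilon> * ln (real n))) + 1 / (1 - q n) - 1"
  have "(\<lambda>n. ln (real n) / real n) \<longlonglongrightarrow> 0"
    by real_asymp
  from tendsto_mult_left[OF this, of "1 - \<epsilon>"] have q0: "q \<longlonglongrightarrow> 0"
    by (simp add: q_def[abs_def])
  \<comment> \<open>The logarithm estimate is applied for arguments up to 1/2; the cutoff also keeps
    \<open>p n\<close> below 1.\<close>
  then have "\<forall>\<^sub>F n in sequentially. q n < 1 / 2"
    by (rule order_tendstoD) simp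
  then have le: "\<forall>\<^sub>F n in sequentially.
      measure_pmf.prob (gnp n (p n)) {E. \<forall>w<n. \<not> isolated E w} \<le> ?b n"
    using eventually_ge_at_top[of 2]
  proof eventually_elim
    case (elim n)
    \<comment> \<open>Together these give \<open>0 \<le> q n\<close>, needed for the logarithm
      estimate, with no case split on the sign of 1 - \<epsilon>.\<close>
    have pn: "0 \<le> p n" "p n \<le> q n" using p[of n] elim by (auto simp: q_def)
    have "exp (ln (real n) + real n * (- q n - 2 * (q n)\<^sup>2))
        \<le> exp (ln (real n) + real n * ln (1 - q n))"
      using pn elim ln_one_minus_pos_lower_bound[of "q n"] by (simp add: mult_left_mono)
    also have "\<dots> = real n * (1 - q n) ^ n"
      using elim by (simp add: exp_add exp_of_nat_mult)
    also have "\<dots> \<le> real n * (1 - q n) ^ (n - 1)"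
      using pn elim by (intro mult_left_mono power_decreasing) auto
    also have "\<dots> \<le> real n * (1 - p n) ^ (n - 1)"
      using pn elim by (intro mult_left_mono power_mono) auto
    finally have "1 / (real n * (1 - p n) ^ (n - 1))
        \<le> 1 / exp (ln (real n) + real n * (- q n - 2 * (q n)\<^sup>2))"
      by (intro divide_left_mono mult_pos_pos) (use pn elim in auto)
    also have "ln (real n) + real n * (- q n - 2 * (q n)\<^sup>2)
        = - (c * ((ln (real n))\<^sup>2 / real n) - \<epsilon> * ln (real n))"
      using elim by (simp add: q_def c_def field_simps power2_eq_square)
    also have "1 / exp \<dots> = exp (c * ((ln (real n))\<^sup>2 / real n)) * exp (- (\<epsilon> * ln (real n)))"
      by (subst exp_minus) (simp add: inverse_eq_divide flip: exp_add)
    finally have "1 / (real n * (1 - p n) ^ (n - 1))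
        \<le> exp (c * ((ln (real n))\<^sup>2 / real n)) * exp (- (\<epsilon> * ln (real n)))" .
    moreover have "1 / (1 - p n) \<le> 1 / (1 - q n)"
      using pn elim by (intro divide_left_mono) auto
    ultimately show ?case
      using prob_no_isolated_le[of "p n" n] pn elim by linarith
  qed
  have sq: "(\<lambda>n. (ln (real n))\<^sup>2 / real n) \<longlonglongrightarrow> 0"
    by real_asymp
  have pw: "(\<lambda>n. exp (- (\<epsilon> * ln (real n)))) \<longlonglongrightarrow> 0"
    using \<epsilon> by real_asymp
  have "?b \<longlonglongrightarrow> exp (c * 0) * 0 + 1 / (1 - 0) - 1"
    by (intro tendsto_intros sq pw q0) simp
  then have "?b \<longlonglongrightarrow> 0"
    by simp
  then show ?thesis
    using le by (intro tendsto_sandwich[OF _ le tendsto_const]) auto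
qed

theorem theorem4:
  shows "\<exists>C>0. \<forall>\<epsilon>>0. \<forall>p :: nat \<Rightarrow> real.
    (\<forall>n\<ge>1. 0 \<le> p n \<and> p n \<le> 1 \<and> p n \<le> (1 - \<epsilon>) * ln (real n) / real n) \<longrightarrow>
    (\<lambda>n. measure_pmf.prob (gnp n (p n))
       {E. (\<forall>\<gamma>::real. \<exists>w<n. search_time n (of_real \<gamma> \<cdot>\<^sub>m adjacency_mat n E) w
                               \<ge> ennreal (C * real n)) \<and>
           (\<forall>\<gamma>::real. \<exists>w<n. search_time n (of_real \<gamma> \<cdot>\<^sub>m laplacian_mat n E) w
                               \<ge> ennreal (C * real n))})
      \<longlonglongrightarrow> 1"
proof (intro exI[of _ 1] conjI allI impI)
  fix \<epsilon> :: real and p :: "nat \<Rightarrow> real"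
  assume \<epsilon>: "\<epsilon> > 0"
    and p: "\<forall>n\<ge>1. 0 \<le> p n \<and> p n \<le> 1 \<and> p n \<le> (1 - \<epsilon>) * ln (real n) / real n"
  \<comment> \<open>The witness for \<open>C\<close> is 1, because the search time at an isolated
    vertex is at least \<open>n\<close>.\<close>
  let ?S = "\<lambda>n. {E. (\<forall>\<gamma>::real. \<exists>w<n. search_time n (of_real \<gamma> \<cdot>\<^sub>m adjacency_mat n E) w
                               \<ge> ennreal (1 * real n)) \<and>
           (\<forall>\<gamma>::real. \<exists>w<n. search_time n (of_real \<gamma> \<cdot>\<^sub>m laplacian_mat n E) w
                               \<ge> ennreal (1 * real n))}"
  let ?N = "\<lambda>n. {E. \<forall>w<n. \<not> isolated E w}"
  show "(\<lambda>n. measure_pmf.prob (gnp n (p n)) (?S n)) \<longlonglongrightarrow> 1"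
  \<comment> \<open>Only the lower bound has content; the upper one is the constant 1.\<close>
  proof (rule tendsto_sandwich)
    show "(\<lambda>n. 1 - measure_pmf.prob (gnp n (p n)) (?N n)) \<longlonglongrightarrow> 1"
      using tendsto_diff[OF tendsto_const prob_no_isolated_tendsto_0[OF \<epsilon>, of p], of 1] p by auto
    have "1 - measure_pmf.prob (gnp n (p n)) (?N n) \<le> measure_pmf.prob (gnp n (p n)) (?S n)" for n
    proof -
      have "- ?N n \<subseteq> ?S n"
        using isolated_not_found by fastforce
      then have "measure_pmf.prob (gnp n (p n)) (- ?N n) \<le> measure_pmf.prob (gnp n (p n)) (?S n)"
        by (intro measure_pmf.finite_measure_mono) auto
      then show ?thesis
        using measure_pmf.prob_compl[of "?N n" "gnp n (p n)"] by (simp add: Compl_eq_Diff_UNIV)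
    qed
    then show "\<forall>\<^sub>F n in sequentially. 1 - measure_pmf.prob (gnp n (p n)) (?N n)
        \<le> measure_pmf.prob (gnp n (p n)) (?S n)"
      by simp
  qed auto
qed simp

end
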